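(* Let $\alpha,\alpha_1,\dots,\alpha_r$ be positive integers with $\alpha<\alpha_1\le\cdots\le\alpha_r$, and let $\boldsymbol{\beta}=(\alpha_1,\dots,\alpha_r)$. Consider the condition ( * ) for any choice of $\epsilon_1,\dots,\epsilon_r\in\{-1,0,1\}$, $\sum_{i=1}^r\epsilon_i\alpha_i=0$ implies $\epsilon_i=0$ for every $i$. If ( * ) holds, then $$\sum_{n\in\mathcal{P}^{\sigma}_{\boldsymbol{\beta}}}n^{-\frac1\alpha}=\prod_{i=1}^rP\left(\frac{\alpha_i}{\alpha}\right).$$ Moreover, condition ( * ) is equivalent to the condition that every $n\in\mathcal{P}^{\sigma}_{\boldsymbol{\beta}}$ has a unique representation as $n=p_1^{\alpha_1}\cdots p_r^{\alpha_r}$, i.e. there is exactly one tuple of primes $(p_1,\dots,p_r)$ with $n=p_1^{\alpha_1}\cdots p_r^{\alpha_r}$.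
   Context: For $\boldsymbol{\beta}=(\alpha_1,\dots,\alpha_r)$ a vector of positive integers, $\mathcal{P}^{\sigma}_{\boldsymbol{\beta}}$ is the set of integers $n$ that can be written as $n=p_1^{\alpha_1}\cdots p_r^{\alpha_r}$ with $p_1,\dots,p_r$ primes, not necessarily distinct (a set, so each integer occurs once). $P(s)=\sum_p p^{-s}$, the sum running over all primes $p$, is the prime zeta function (convergent for real $s>1$). *)

theory Defs
  imports "HOL-Analysis.Analysis" "HOL-Computational_Algebra.Primes"
begin

text \<open>A vector \<open>(\<alpha>\<^sub>1, \<dots>, \<alpha>\<^sub>r)\<close> is a list \<open>\<beta>\<close> of length \<open>r\<close>, so \<open>\<alpha>\<^sub>i\<close> is \<open>\<beta> ! (i - 1)\<close>; tuples
  of primes and of signs are lists of the same length.\<close>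

definition prime_tuples :: "nat \<Rightarrow> nat list set" where
  "prime_tuples r = {ps. length ps = r \<and> (\<forall>p\<in>set ps. prime p)}"

definition prime_power_prod :: "nat list \<Rightarrow> nat list \<Rightarrow> nat" where
  "prime_power_prod \<beta> ps = (\<Prod>i<length \<beta>. (ps ! i) ^ (\<beta> ! i))"

definition P_sigma :: "nat list \<Rightarrow> nat set" where
  "P_sigma \<beta> = {prime_power_prod \<beta> ps | ps. ps \<in> prime_tuples (length \<beta>)}"

definition prime_zeta :: "real \<Rightarrow> real" where
  "prime_zeta s = (\<Sum>\<^sub>\<infinity>p\<in>{p::nat. prime p}. real p powr (- s))"

text \<open>Since \<open>infsum\<close> is 0 for a family that is not summable, \<open>prime_zeta s\<close> is meaningful only where the
  series converges, in particular for \<open>s > 1\<close>.\<close>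

lemma prime_zeta_has_sum:
  assumes "s > 1"
  shows "((\<lambda>p. real p powr (- s)) has_sum prime_zeta s) {p::nat. prime p}"
proof -
  have "summable (\<lambda>n. real n powr (- s))"
    using assms by (simp add: summable_real_powr_iff)
  then have "(\<lambda>n. real n powr (- s)) summable_on UNIV"
    by (intro norm_summable_imp_summable_on) simp
  then have "(\<lambda>p. real p powr (- s)) summable_on {p::nat. prime p}"
    by (rule summable_on_subset_banach) simp
  then show ?thesis
    unfolding prime_zeta_def by (rule has_sum_infsum)
qed

definition only_trivial_signed_sum :: "nat list \<Rightarrow> bool" where
  "only_trivial_signed_sum \<beta> \<longleftrightarrow>
    (\<forall>\<epsilon>::int list. length \<epsilon> = length \<beta> \<and> set \<epsilon> \<subseteq> {-1, 0, 1} \<and>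
       (\<Sum>i<length \<beta>. \<epsilon> ! i * int (\<beta> ! i)) = 0 \<longrightarrow> (\<forall>i<length \<beta>. \<epsilon> ! i = 0))"

end

theory Submission
  imports Defs
begin

text \<open>For a prime \<open>q\<close>, the \<open>q\<close>-adic valuation of \<open>p\<^sub>1\<^bsup>\<alpha>\<^sub>1\<^esup> \<cdots> p\<^sub>r\<^bsup>\<alpha>\<^sub>r\<^esup>\<close> is the sum of the
  \<open>\<alpha>\<^sub>i\<close> with \<open>p\<^sub>i = q\<close>. So if two tuples of primes give the same integer, the differences
  \<open>\<epsilon>\<^sub>i = [p\<^sub>i = q] - [p'\<^sub>i = q]\<close> form a vanishing signed sum, for every \<open>q\<close>; condition (*) makes all
  of them zero and the tuples equal. Conversely a nontrivial vanishing signed sum \<open>\<epsilon>\<close> gives two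
  different tuples of 2s and 3s with the same product, one with its 3s where \<open>\<epsilon>\<^sub>i = 1\<close> and the
  other with its 3s where \<open>\<epsilon>\<^sub>i = -1\<close>. Under uniqueness the sum over \<open>P_sigma \<beta>\<close> is a sum
  over all tuples of primes, which factorises.\<close>

text \<open>Induction on \<open>n\<close>: the head of the list is split off, and the induction
  hypothesis is applied to the families \<open>f\<close> and \<open>S\<close> shifted by one
  index.\<close>

lemma has_sum_prod_lists:
  fixes f :: "nat \<Rightarrow> 'a \<Rightarrow> real"
  assumes "\<And>i. i < n \<Longrightarrow> (f i has_sum S i) A"
    and "\<And>i x. i < n \<Longrightarrow> x \<in> A \<Longrightarrow> 0 \<le> f i x"
  shows "((\<lambda>xs. \<Prod>i<n. f i (xs ! i)) has_sum (\<Prod>i<n. S i)) {xs. length xs = n \<and> set xs \<subseteq> A}"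
  using assms
proof (induction n arbitrary: f S)
  case 0
  have "{xs. length xs = 0 \<and> set xs \<subseteq> A} = {[]}"
    by auto
  then show ?case
    using has_sum_finite[of "{[]}" "\<lambda>_. 1 :: real"] by simp
next
  case (Suc n)
  let ?L = "\<lambda>n. {xs. length xs = n \<and> set xs \<subseteq> A}"
  let ?g = "\<lambda>xs. \<Prod>i<n. f (Suc i) (xs ! i)"
  let ?T = "\<Prod>i<n. S (Suc i)"
  have g: "(?g has_sum ?T) (?L n)"
    by (rule Suc.IH) (use Suc.prems in auto)
  have g0: "0 \<le> ?g xs" if "xs \<in> ?L n" for xs
    using that by (intro prod_nonneg) (auto intro!: Suc.prems(2) dest: nth_mem)
  have inner: "((\<lambda>xs. f 0 x * ?g xs) has_sum f 0 x * ?T) (?L n)" for x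
    by (rule has_sum_cmult_right) (rule g)
  have outer: "((\<lambda>x. f 0 x * ?T) has_sum S 0 * ?T) A"
    by (rule has_sum_cmult_left) (use Suc.prems(1)[of 0] in simp)
  \<comment> \<open>Tonelli: the terms are nonnegative and the iterated sums converge, so the family
    is summable over pairs of head and tail.\<close>
  have "(\<lambda>z. f 0 (fst z) * ?g (snd z)) summable_on A \<times> ?L n"
    by (rule summable_on_SigmaI[where g = "\<lambda>x. f 0 x * ?T"])
       (use inner has_sum_imp_summable[OF outer] g0 Suc.prems(2) in auto)
  then have "((\<lambda>z. f 0 (fst z) * ?g (snd z)) has_sum S 0 * ?T) (A \<times> ?L n)"
    by (intro has_sum_SigmaI[OF _ outer]) (use inner in auto)
  moreover have "bij_betw (\<lambda>(x, xs). x # xs) (A \<times> ?L n) (?L (Suc n))"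
    by (auto simp: bij_betw_def inj_on_def image_def length_Suc_conv)
  ultimately show ?case
    by (subst has_sum_reindex_bij_betw[symmetric])
       (auto simp: case_prod_unfold prod.lessThan_Suc_shift simp del: prod.lessThan_Suc)
qed

lemma multiplicity_prime_power_prod:
  assumes "ps \<in> prime_tuples (length \<beta>)" and "prime q"
  shows "multiplicity q (prime_power_prod \<beta> ps) = (\<Sum>i<length \<beta>. if ps ! i = q then \<beta> ! i else 0)"
proof -
  have pr: "prime (ps ! i)" if "i < length \<beta>" for i
    using assms(1) that by (auto simp: prime_tuples_def)
  have "multiplicity q (prime_power_prod \<beta> ps) = (\<Sum>i<length \<beta>. multiplicity q ((ps ! i) ^ (\<beta> ! i)))"
    unfolding prime_power_prod_def
    by (rule prime_elem_multiplicity_prod_distrib) (use assms(2) pr in \<open>auto dest!: pr\<close>)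
  also have "\<dots> = (\<Sum>i<length \<beta>. if ps ! i = q then \<beta> ! i else 0)"
    by (rule sum.cong) (use assms(2) pr in \<open>auto simp: multiplicity_distinct_prime_power\<close>)
  finally show ?thesis .
qed

lemma only_trivial_signed_sum_imp_inj:
  assumes "only_trivial_signed_sum \<beta>"
  shows "inj_on (prime_power_prod \<beta>) (prime_tuples (length \<beta>))"
proof (rule inj_onI)
  fix ps qs
  assume ps: "ps \<in> prime_tuples (length \<beta>)" and qs: "qs \<in> prime_tuples (length \<beta>)"
    and eq: "prime_power_prod \<beta> ps = prime_power_prod \<beta> qs"
  have "qs ! i = ps ! i" if i: "i < length \<beta>" for i
  proof -
    \<comment> \<open>For this choice of \<open>q\<close>, the sign \<open>\<epsilon> ! i\<close> is
      1 unless \<open>qs ! i = q\<close> too, so its vanishing settles position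
      \<open>i\<close>.\<close>
    define q where "q = ps ! i"
    define \<epsilon> :: "int list"
      where "\<epsilon> = map (\<lambda>i. of_bool (ps ! i = q) - of_bool (qs ! i = q)) [0..<length \<beta>]"
    have q: "prime q"
      using ps i by (auto simp: prime_tuples_def q_def)
    have "(\<Sum>i<length \<beta>. \<epsilon> ! i * int (\<beta> ! i)) =
        (\<Sum>i<length \<beta>. int (if ps ! i = q then \<beta> ! i else 0) - int (if qs ! i = q then \<beta> ! i else 0))"
      by (rule sum.cong) (auto simp: \<epsilon>_def)
    also have "\<dots> = int (multiplicity q (prime_power_prod \<beta> ps)) - int (multiplicity q (prime_power_prod \<beta> qs))"
      by (simp only: sum_subtractf of_nat_sum multiplicity_prime_power_prod[OF ps q]
          multiplicity_prime_power_prod[OF qs q])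
    finally have "(\<Sum>i<length \<beta>. \<epsilon> ! i * int (\<beta> ! i)) = 0"
      by (simp add: eq)
    moreover have "length \<epsilon> = length \<beta>" "set \<epsilon> \<subseteq> {-1, 0, 1}"
      by (auto simp: \<epsilon>_def of_bool_def split: if_splits)
    ultimately have "\<epsilon> ! i = 0"
      using assms i unfolding only_trivial_signed_sum_def by blast
    then show ?thesis
      using i by (simp add: \<epsilon>_def q_def split: if_splits)
  qed
  then show "ps = qs"
    using ps qs by (intro nth_equalityI) (auto simp: prime_tuples_def)
qed

lemma inj_imp_only_trivial_signed_sum:
  assumes "inj_on (prime_power_prod \<beta>) (prime_tuples (length \<beta>))"
  shows "only_trivial_signed_sum \<beta>"
  unfolding only_trivial_signed_sum_def
proof (intro allI impI, elim conjE)
  fix \<epsilon> :: "int list" and i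
  assume len: "length \<epsilon> = length \<beta>" and sgn: "set \<epsilon> \<subseteq> {-1, 0, 1}"
    and zero: "(\<Sum>i<length \<beta>. \<epsilon> ! i * int (\<beta> ! i)) = 0" and i: "i < length \<beta>"
  \<comment> \<open>\<open>t c\<close> has its 3s where the sign is \<open>c\<close>;
    \<open>w c\<close> is the resulting exponent of 3. All exponents add up to \<open>T\<close>,
    which leaves \<open>T - w c\<close> for 2.\<close>
  define t where "t c = map (\<lambda>i. if \<epsilon> ! i = c then 3 else 2 :: nat) [0..<length \<beta>]" for c
  define w where "w c = (\<Sum>i<length \<beta>. if \<epsilon> ! i = c then \<beta> ! i else 0)" for c
  define T where "T = (\<Sum>i<length \<beta>. \<beta> ! i)"
  have sgn': "\<epsilon> ! i = -1 \<or> \<epsilon> ! i = 0 \<or> \<epsilon> ! i = 1" if "i < length \<beta>" for i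
  proof -
    have "\<epsilon> ! i \<in> set \<epsilon>"
      using len that by simp
    then show ?thesis
      using sgn by blast
  qed
  have t: "t c \<in> prime_tuples (length \<beta>)" for c
    by (auto simp: t_def prime_tuples_def)
  have prod_t: "prime_power_prod \<beta> (t c) = 3 ^ w c * 2 ^ (T - w c)" for c
  proof -
    have "T = w c + (\<Sum>i<length \<beta>. if \<epsilon> ! i = c then 0 else \<beta> ! i)"
      unfolding T_def w_def sum.distrib[symmetric] by (rule sum.cong) auto
    moreover have "prime_power_prod \<beta> (t c) =
        (\<Prod>i<length \<beta>. 3 ^ (if \<epsilon> ! i = c then \<beta> ! i else 0) * 2 ^ (if \<epsilon> ! i = c then 0 else \<beta> ! i))"
      unfolding prime_power_prod_def by (rule prod.cong) (auto simp: t_def)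
    ultimately show ?thesis
      by (simp add: prod.distrib power_sum w_def)
  qed
  have "int (w 1) - int (w (-1)) = (\<Sum>i<length \<beta>. \<epsilon> ! i * int (\<beta> ! i))"
    unfolding w_def of_nat_sum sum_subtractf[symmetric]
    by (rule sum.cong) (auto dest!: sgn')
  then have "w 1 = w (-1)"
    using zero by simp
  then have "prime_power_prod \<beta> (t 1) = prime_power_prod \<beta> (t (-1))"
    by (simp add: prod_t)
  then have "t 1 = t (-1)"
    using assms t by (auto dest: inj_onD)
  \<comment> \<open>Sign 1 would make these entries 3 and 2, sign -1 would make them 2 and 3;
    equality leaves only sign 0.\<close>
  then have "t 1 ! i = t (-1) ! i"
    by simp
  then show "\<epsilon> ! i = 0"
    using i sgn'[OF i] by (auto simp: t_def)
qed

lemma P_sigma_eq: "P_sigma \<beta> = prime_power_prod \<beta> ` prime_tuples (length \<beta>)"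
  by (auto simp: P_sigma_def)

text \<open>Each tuple contributes its own term, and this term is a product over positions, so the
  sum factorises. The bound on \<open>\<beta> ! i\<close> puts every argument of
  \<open>prime_zeta\<close> above 1, where the series converges.\<close>

lemma has_sum_prime_tuples:
  assumes "0 < \<alpha>" and "\<And>i. i < length \<beta> \<Longrightarrow> \<alpha> < \<beta> ! i"
  shows "((\<lambda>ps. real (prime_power_prod \<beta> ps) powr (- 1 / real \<alpha>)) has_sum
      (\<Prod>i<length \<beta>. prime_zeta (real (\<beta> ! i) / real \<alpha>))) (prime_tuples (length \<beta>))"
proof -
  let ?f = "\<lambda>i p. real p powr (- (real (\<beta> ! i) / real \<alpha>))"
  have tuples: "prime_tuples (length \<beta>) = {ps. length ps = length \<beta> \<and> set ps \<subseteq> {p. prime p}}"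
    by (auto simp: prime_tuples_def)
  have "((\<lambda>ps. \<Prod>i<length \<beta>. ?f i (ps ! i)) has_sum
      (\<Prod>i<length \<beta>. prime_zeta (real (\<beta> ! i) / real \<alpha>))) (prime_tuples (length \<beta>))"
    unfolding tuples
    by (rule has_sum_prod_lists) (use assms in \<open>auto intro!: prime_zeta_has_sum\<close>)
  moreover have "real (prime_power_prod \<beta> ps) powr (- 1 / real \<alpha>) = (\<Prod>i<length \<beta>. ?f i (ps ! i))"
    if ps: "ps \<in> prime_tuples (length \<beta>)" for ps
  proof -
    have "real (prime_power_prod \<beta> ps) powr (- 1 / real \<alpha>) =
        (\<Prod>i<length \<beta>. (real (ps ! i) ^ (\<beta> ! i)) powr (- 1 / real \<alpha>))"
      unfolding prime_power_prod_def by (simp add: prod_powr_distrib)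
    also have "\<dots> = (\<Prod>i<length \<beta>. ?f i (ps ! i))"
    proof (rule prod.cong)
      fix i assume "i \<in> {..<length \<beta>}"
      then have "prime (ps ! i)"
        using ps by (auto simp: prime_tuples_def)
      then have "0 < real (ps ! i)"
        by (simp add: prime_gt_0_nat)
      then show "(real (ps ! i) ^ (\<beta> ! i)) powr (- 1 / real \<alpha>) = ?f i (ps ! i)"
        by (simp add: powr_powr flip: powr_realpow)
    qed simp
    finally show ?thesis .
  qed
  ultimately show ?thesis
    by (simp cong: has_sum_cong)
qed

theorem theorem2:
  fixes \<alpha> :: nat and \<beta> :: "nat list"
  assumes "0 < \<alpha>" and "\<beta> \<noteq> []" and "\<alpha> < \<beta> ! 0" and "sorted \<beta>"
  shows "(only_trivial_signed_sum \<beta> \<longrightarrow>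
           ((\<lambda>n. real n powr (- 1 / real \<alpha>)) has_sum
              (\<Prod>i<length \<beta>. prime_zeta (real (\<beta> ! i) / real \<alpha>))) (P_sigma \<beta>)) \<and>
         (only_trivial_signed_sum \<beta> \<longleftrightarrow>
           (\<forall>n\<in>P_sigma \<beta>. \<exists>!ps. ps \<in> prime_tuples (length \<beta>) \<and> n = prime_power_prod \<beta> ps))"
proof (intro conjI impI)
  have gt: "\<alpha> < \<beta> ! i" if "i < length \<beta>" for i
    using sorted_nth_mono[OF assms(4), of 0 i] assms(3) that by simp
  assume "only_trivial_signed_sum \<beta>"
  then have "inj_on (prime_power_prod \<beta>) (prime_tuples (length \<beta>))"
    by (rule only_trivial_signed_sum_imp_inj)
  then show "((\<lambda>n. real n powr (- 1 / real \<alpha>)) has_sum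
      (\<Prod>i<length \<beta>. prime_zeta (real (\<beta> ! i) / real \<alpha>))) (P_sigma \<beta>)"
    unfolding P_sigma_eq
    \<comment> \<open>By injectivity each integer of the image comes from one tuple, so both sums
      have the same terms.\<close>
    by (subst has_sum_reindex) (use has_sum_prime_tuples[OF assms(1) gt] in \<open>auto simp: o_def\<close>)
next
  have "only_trivial_signed_sum \<beta> \<longleftrightarrow> inj_on (prime_power_prod \<beta>) (prime_tuples (length \<beta>))"
    using only_trivial_signed_sum_imp_inj inj_imp_only_trivial_signed_sum by blast
  also have "\<dots> \<longleftrightarrow>
      (\<forall>n\<in>P_sigma \<beta>. \<exists>!ps. ps \<in> prime_tuples (length \<beta>) \<and> n = prime_power_prod \<beta> ps)"
    \<comment> \<open>On an image, existence of a preimage is automatic, so unique existence amounts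
      to injectivity.\<close>
    unfolding P_sigma_eq inj_on_def by (auto; metis)
  finally show "only_trivial_signed_sum \<beta> \<longleftrightarrow>
      (\<forall>n\<in>P_sigma \<beta>. \<exists>!ps. ps \<in> prime_tuples (length \<beta>) \<and> n = prime_power_prod \<beta> ps)" .
qed

end
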